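(* For a catalysis with degeneracy vector $\mathbf{r}=(r_1,\dots,r_n)$, and any $\alpha\in(0,1)\cup(1,\infty)$, the maximal catalytic Rényi entropy $S_\alpha^\diamond(\sigma)$ over compatible catalysts $\sigma$ (with degeneracy vector $\mathbf{r}$) is $2\log_2\|\mathbf{r}\|_2$, where $\|\mathbf{r}\|_2=\sqrt{r_1^2+\cdots+r_n^2}$.
   Context: All systems are finite-dimensional. Let $U$ be a unitary on $\mathcal{H}_A\otimes\mathcal{H}_B$, and let $\Pi_1,\dots,\Pi_n$ be mutually orthogonal projectors on $\mathcal{H}_B$ with $\sum_i\Pi_i=\mathbb{1}_B$ and $r_i=\mathrm{Tr}\,\Pi_i\ge1$, such that each $\pi_i=\frac1{r_i}\Pi_i$ is itself a catalyst for $U$ and is preserved, i.e. $\mathrm{Tr}_A\,U(\rho_A\otimes\pi_i)U^\dagger=\pi_i$ for all states $\rho$ on $A$. A compatible catalyst then has the form $\sigma=\sum_i\lambda_i\Pi_i$ with $\lambda_i\ge0$, $\sum_i\lambda_ir_i=1$ (the $\lambda_i$ need not be distinct); $\mathbf{r}=(r_1,\dots,r_n)$ is called the degeneracy vector of the catalysis (or of the catalyst). The catalytic Rényi entropy of $\sigma$ with respect to this decomposition is $S_\alpha^\diamond(\sigma)=\frac1{1-\alpha}\log_2\sum_i\lambda_i^\alpha r_i^{2-\alpha}$. (Typical situation: a conservation law for a quantity with projectors $\{\Pi_q\}$ on the catalyst system forces all states and unitaries to commute with every $\Pi_q$.) *)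

theory Defs
  imports "HOL-Analysis.Analysis"
begin

text \<open>
  A finite-dimensional Hilbert space is coordinatised as \<open>complex ^ 'd\<close> for a finite index type
  \<open>'d\<close>; the tensor product of the spaces indexed by \<open>'a\<close> and \<open>'b\<close> is indexed by \<open>'a \<times> 'b\<close>.
\<close>

type_synonym 'd operator = "complex ^ 'd ^ 'd"

definition adjoint_op :: "'d::finite operator \<Rightarrow> 'd operator" where
  "adjoint_op M = (\<chi> i j. cnj (M $ j $ i))"

definition hermitian_op :: "'d::finite operator \<Rightarrow> bool" where
  "hermitian_op M \<longleftrightarrow> adjoint_op M = M"

definition unitary_op :: "'d::finite operator \<Rightarrow> bool" where
  "unitary_op M \<longleftrightarrow> adjoint_op M ** M = mat 1 \<and> M ** adjoint_op M = mat 1"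

definition projector :: "'d::finite operator \<Rightarrow> bool" where
  "projector M \<longleftrightarrow> hermitian_op M \<and> M ** M = M"

definition positive_op :: "'d::finite operator \<Rightarrow> bool" where
  "positive_op M \<longleftrightarrow> hermitian_op M \<and>
     (\<forall>v :: complex ^ 'd. 0 \<le> Re (\<Sum>i\<in>UNIV. cnj (v $ i) * (M *v v) $ i))"

definition density_op :: "'d::finite operator \<Rightarrow> bool" where
  "density_op M \<longleftrightarrow> positive_op M \<and> trace M = 1"

definition tensor_op :: "'a::finite operator \<Rightarrow> 'b::finite operator \<Rightarrow> ('a \<times> 'b) operator" where
  "tensor_op M N = (\<chi> p q. M $ fst p $ fst q * N $ snd p $ snd q)"

text \<open>Partial trace over the first tensor factor.\<close>

definition partial_trace_A :: "('a::finite \<times> 'b::finite) operator \<Rightarrow> 'b operator" where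
  "partial_trace_A M = (\<chi> k l. \<Sum>i\<in>UNIV. M $ (i, k) $ (i, l))"

definition preserved_catalyst ::
  "('a::finite \<times> 'b::finite) operator \<Rightarrow> 'b operator \<Rightarrow> bool" where
  "preserved_catalyst U \<sigma> \<longleftrightarrow> density_op \<sigma> \<and>
     (\<forall>\<rho> :: 'a operator. density_op \<rho> \<longrightarrow>
        partial_trace_A (U ** tensor_op \<rho> \<sigma> ** adjoint_op U) = \<sigma>)"

text \<open>
  A family of projectors is indexed by a finite type \<open>'n\<close> with \<open>n = CARD('n)\<close> elements, so that
  the degeneracy vector lives in \<open>real ^ 'n\<close> and its 2-norm is the library's \<open>norm\<close>.
  The trace of a projector is real, so taking \<open>Re\<close> loses nothing.
\<close>

definition degeneracy_vector :: "('n::finite \<Rightarrow> 'b::finite operator) \<Rightarrow> real ^ 'n" where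
  "degeneracy_vector P = (\<chi> i. Re (trace (P i)))"

definition catalysis ::
  "('a::finite \<times> 'b::finite) operator \<Rightarrow> ('n::finite \<Rightarrow> 'b operator) \<Rightarrow> bool" where
  "catalysis U P \<longleftrightarrow>
     unitary_op U \<and>
     (\<forall>i. projector (P i)) \<and>
     (\<forall>i j. i \<noteq> j \<longrightarrow> P i ** P j = 0) \<and>
     (\<Sum>i\<in>UNIV. P i) = mat 1 \<and>
     (\<forall>i. 1 \<le> degeneracy_vector P $ i) \<and>
     (\<forall>i. preserved_catalyst U ((1 / degeneracy_vector P $ i) *\<^sub>R P i))"

definition compatible_catalyst ::
  "('a::finite \<times> 'b::finite) operator \<Rightarrow> ('n::finite \<Rightarrow> 'b operator) \<Rightarrow> 'b operator \<Rightarrow> bool" where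
  "compatible_catalyst U P \<sigma> \<longleftrightarrow>
     preserved_catalyst U \<sigma> \<and>
     (\<exists>lam :: real ^ 'n. (\<forall>i. 0 \<le> lam $ i) \<and>
        (\<Sum>i\<in>UNIV. lam $ i * degeneracy_vector P $ i) = 1 \<and>
        \<sigma> = (\<Sum>i\<in>UNIV. lam $ i *\<^sub>R P i))"

text \<open>
  The coefficients of \<open>\<sigma>\<close> in the decomposition; they are unique because nonzero mutually
  orthogonal projectors are linearly independent.
\<close>

definition decomposition_coeffs ::
  "('n::finite \<Rightarrow> 'b::finite operator) \<Rightarrow> 'b operator \<Rightarrow> real ^ 'n" where
  "decomposition_coeffs P \<sigma> = (THE lam. \<sigma> = (\<Sum>i\<in>UNIV. lam $ i *\<^sub>R P i))"

definition catalytic_renyi_entropy ::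
  "real \<Rightarrow> ('n::finite \<Rightarrow> 'b::finite operator) \<Rightarrow> 'b operator \<Rightarrow> real" where
  "catalytic_renyi_entropy \<alpha> P \<sigma> =
     1 / (1 - \<alpha>) * log 2 (\<Sum>i\<in>UNIV. (decomposition_coeffs P \<sigma> $ i) powr \<alpha> *
                                     (degeneracy_vector P $ i) powr (2 - \<alpha>))"

end

theory Submission
  imports Defs
begin

text \<open>
  With \<open>R = \<parallel>r\<parallel>\<^sup>2\<close>, weights \<open>w i = r i\<^sup>2 / R\<close> and ratios \<open>x i = R * lam i / r i\<close>,
  the weighted mean of the ratios is \<open>1\<close>, and
  \<open>(\<Sum>i. lam i powr \<alpha> * r i powr (2 - \<alpha>)) = R powr (1 - \<alpha>) * (\<Sum>i. w i * x i powr \<alpha>)\<close>.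
  Jensen's inequality, in the form of the tangent line of \<open>x powr \<alpha>\<close> at \<open>1\<close>, compares the last sum
  with \<open>1\<close>, and \<open>lam = r / R\<close> gives equality.
\<close>

text \<open>Weighted AM-GM for the numbers \<open>x\<close> and \<open>1\<close> with weights
  \<open>a\<close> and \<open>1 - a\<close>. That inequality asks for positive arguments, so
  \<open>x = 0\<close> is settled separately; there the claim is
  \<open>0 \<le> 1 - a\<close>.\<close>

lemma powr_le_tangent:
  fixes a x :: real
  assumes "0 < a" "a < 1" "0 \<le> x"
  shows "x powr a \<le> 1 + a * (x - 1)"
proof (cases "x = 0")
  case False
  then show ?thesis
    using assms Youngs_inequality_0[of a "1 - a" x 1] by (simp add: algebra_simps)
qed (use assms in auto)

text \<open>The concave case, applied with exponent \<open>1 / a\<close> at the point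
  \<open>x powr a\<close>, bounds \<open>x\<close> from above; solving that bound for
  \<open>x powr a\<close> gives the convex case.\<close>

lemma powr_ge_tangent:
  fixes a x :: real
  assumes "1 < a" "0 \<le> x"
  shows "x powr a \<ge> 1 + a * (x - 1)"
proof -
  have "(x powr a) powr (1 / a) \<le> 1 + (1 / a) * (x powr a - 1)"
    using assms by (intro powr_le_tangent) auto
  then have "x \<le> 1 + (x powr a - 1) / a"
    using assms by (simp add: powr_powr)
  then have "a * x \<le> a * (1 + (x powr a - 1) / a)"
    using assms by (intro mult_left_mono) auto
  also have "\<dots> = a + (x powr a - 1)"
    using assms by (simp add: distrib_left)
  finally show ?thesis
    by (simp add: right_diff_distrib)
qed

text \<open>The identity holds term by term: the powers of \<open>R\<close> cancel because
  \<open>(1 - \<alpha>) - 1 + \<alpha> = 0\<close>, and those of \<open>r i\<close> add up to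
  \<open>2 - \<alpha>\<close>.\<close>

lemma powr_sum_rescale:
  fixes lam r :: "'n::finite \<Rightarrow> real"
  assumes "0 < R" "\<And>i. 0 \<le> lam i" "\<And>i. 0 < r i"
  shows "(\<Sum>i\<in>UNIV. lam i powr \<alpha> * r i powr (2 - \<alpha>)) =
         R powr (1 - \<alpha>) * (\<Sum>i\<in>UNIV. (r i)\<^sup>2 / R * (R * lam i / r i) powr \<alpha>)"
proof -
  have "lam i powr \<alpha> * r i powr (2 - \<alpha>) =
      R powr (1 - \<alpha>) * ((r i)\<^sup>2 / R * (R * lam i / r i) powr \<alpha>)" for i
    using assms(1) assms(2)[of i] assms(3)[of i]
    by (simp add: powr_mult powr_divide powr_diff)
  then show ?thesis
    by (simp add: sum_distrib_left)
qed

lemma powr_sum_entropy_le: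
  fixes lam r :: "'n::finite \<Rightarrow> real"
  assumes lam: "\<And>i. 0 \<le> lam i" and r: "\<And>i. 0 < r i"
    and norm1: "(\<Sum>i\<in>UNIV. lam i * r i) = 1"
    and \<alpha>: "0 < \<alpha>" "\<alpha> \<noteq> 1"
  shows "1 / (1 - \<alpha>) * log 2 (\<Sum>i\<in>UNIV. lam i powr \<alpha> * r i powr (2 - \<alpha>))
         \<le> log 2 (\<Sum>i\<in>UNIV. (r i)\<^sup>2)"
proof -
  define R where "R = (\<Sum>i\<in>UNIV. (r i)\<^sup>2)"
  define S where "S = (\<Sum>i\<in>UNIV. lam i powr \<alpha> * r i powr (2 - \<alpha>))"
  define T where "T = (\<Sum>i\<in>UNIV. (r i)\<^sup>2 / R * (R * lam i / r i) powr \<alpha>)"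
  have R: "0 < R"
    unfolding R_def by (intro sum_pos zero_less_power r) simp_all
  have ST: "S = R powr (1 - \<alpha>) * T"
    unfolding S_def T_def by (rule powr_sum_rescale[OF R lam r])
  have "(\<Sum>i\<in>UNIV. (r i)\<^sup>2 / R) = 1"
    using R by (simp add: R_def flip: sum_divide_distrib)
  \<comment> \<open>The tangent line is affine in the ratio, so its weighted mean only involves the
    total weight and the normalisation of \<open>lam\<close>, both equal to 1.\<close>
  moreover have "(r i)\<^sup>2 / R * (1 + \<alpha> * (R * lam i / r i - 1))
      = (1 - \<alpha>) * ((r i)\<^sup>2 / R) + \<alpha> * (lam i * r i)" for i
    using R r[of i] by (simp add: field_simps power2_eq_square)
  then have "(\<Sum>i\<in>UNIV. (r i)\<^sup>2 / R * (1 + \<alpha> * (R * lam i / r i - 1)))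
      = (1 - \<alpha>) * (\<Sum>i\<in>UNIV. (r i)\<^sup>2 / R) + \<alpha> * (\<Sum>i\<in>UNIV. lam i * r i)"
    by (simp only: sum.distrib sum_distrib_left)
  ultimately have mean: "(\<Sum>i\<in>UNIV. (r i)\<^sup>2 / R * (1 + \<alpha> * (R * lam i / r i - 1))) = 1"
    by (simp only: norm1) simp
  \<comment> \<open>Splitting the logarithm of the product requires positive factors. The
    normalisation rules out that all coefficients vanish, so one term of \<open>S\<close> is
    strictly positive.\<close>
  obtain j where "lam j * r j \<noteq> 0"
    using norm1 by (metis sum.neutral zero_neq_one)
  then have "0 < lam j"
    using lam[of j] by (simp add: less_le)
  then have S: "0 < S"
    unfolding S_def using r[of j] by (intro sum_pos2[of _ j]) auto
  have T: "0 < T"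
    using S R ST by (simp add: zero_less_mult_iff)
  have log_S: "log 2 S = (1 - \<alpha>) * log 2 R + log 2 T"
    using R T ST by (simp add: log_mult log_powr)
  have x: "0 \<le> R * lam i / r i" for i
    using R lam[of i] r[of i] by simp
  \<comment> \<open>Concavity gives \<open>T \<le> 1\<close> for \<open>\<alpha> < 1\<close>,
    convexity gives \<open>T \<ge> 1\<close> for \<open>\<alpha> > 1\<close>. The sign of the
    denominator flips along with that of the bound on \<open>log 2 T\<close>, so one upper bound
    serves both ranges.\<close>
  have "log 2 T / (1 - \<alpha>) \<le> 0"
  proof (cases "\<alpha> < 1")
    case True
    have "T \<le> (\<Sum>i\<in>UNIV. (r i)\<^sup>2 / R * (1 + \<alpha> * (R * lam i / r i - 1)))"
      unfolding T_def using R True \<alpha> x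
      by (intro sum_mono mult_left_mono powr_le_tangent) auto
    then show ?thesis
      using T mean True by (simp add: divide_nonpos_pos)
  next
    case False
    have "(\<Sum>i\<in>UNIV. (r i)\<^sup>2 / R * (1 + \<alpha> * (R * lam i / r i - 1))) \<le> T"
      unfolding T_def using R False \<alpha> x
      by (intro sum_mono mult_left_mono powr_ge_tangent) auto
    then show ?thesis
      using T mean False \<alpha> by (simp add: divide_nonneg_neg)
  qed
  moreover have "1 / (1 - \<alpha>) * log 2 S = log 2 R + log 2 T / (1 - \<alpha>)"
    using \<alpha> by (simp add: log_S add_divide_distrib)
  ultimately show ?thesis
    by (simp add: S_def R_def)
qed

text \<open>For these coefficients all ratios equal 1, so the rescaled sum is the total weight 1 and
  only the factor \<open>R powr (1 - \<alpha>)\<close> remains.\<close>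

lemma powr_sum_entropy_eq:
  fixes r :: "'n::finite \<Rightarrow> real"
  assumes r: "\<And>i. 0 < r i" and \<alpha>: "\<alpha> \<noteq> 1"
    and R: "R = (\<Sum>i\<in>UNIV. (r i)\<^sup>2)"
  shows "1 / (1 - \<alpha>) * log 2 (\<Sum>i\<in>UNIV. (r i / R) powr \<alpha> * r i powr (2 - \<alpha>)) = log 2 R"
proof -
  have R0: "0 < R"
    unfolding R by (intro sum_pos zero_less_power r) simp_all
  have "(\<Sum>i\<in>UNIV. (r i / R) powr \<alpha> * r i powr (2 - \<alpha>)) =
      R powr (1 - \<alpha>) * (\<Sum>i\<in>UNIV. (r i)\<^sup>2 / R * (R * (r i / R) / r i) powr \<alpha>)"
    using R0 r by (intro powr_sum_rescale) (auto simp: less_imp_le)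
  also have "(\<Sum>i\<in>UNIV. (r i)\<^sup>2 / R * (R * (r i / R) / r i) powr \<alpha>) = (\<Sum>i\<in>UNIV. (r i)\<^sup>2 / R)"
    using R0 r by (intro sum.cong) (auto simp: less_imp_neq[OF r, symmetric])
  also have "\<dots> = 1"
    using R0 by (simp add: R flip: sum_divide_distrib)
  finally show ?thesis
    using R0 \<alpha> by (simp add: log_powr)
qed

lemma matrix_sum_scaleR_mult:
  fixes P :: "'n::finite \<Rightarrow> 'b::finite operator"
  shows "(\<Sum>i\<in>UNIV. c i *\<^sub>R P i) ** M = (\<Sum>i\<in>UNIV. c i *\<^sub>R (P i ** M))"
  by (simp add: vec_eq_iff matrix_matrix_mult_def sum_distrib_right scaleR_sum_right
      sum.swap[of _ "UNIV :: 'n set"])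

text \<open>Multiplying by \<open>P j\<close> on the right annihilates every other term, and the
  nonzero \<open>P j\<close> then determines its coefficient. Hence the definite description really
  denotes the given coefficients.\<close>

lemma decomposition_coeffs_eq:
  fixes P :: "'n::finite \<Rightarrow> 'b::finite operator"
  assumes orth: "\<And>i j. i \<noteq> j \<Longrightarrow> P i ** P j = 0"
    and idem: "\<And>i. P i ** P i = P i" and nz: "\<And>i. P i \<noteq> 0"
  shows "decomposition_coeffs P (\<Sum>i\<in>UNIV. lam $ i *\<^sub>R P i) = lam"
proof -
  have pick: "(\<Sum>i\<in>UNIV. c $ i *\<^sub>R P i) ** P j = c $ j *\<^sub>R P j" for c :: "real ^ 'n" and j
  proof -
    have "(\<Sum>i\<in>UNIV. c $ i *\<^sub>R P i) ** P j = (\<Sum>i\<in>UNIV. if i = j then c $ j *\<^sub>R P j else 0)"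
      unfolding matrix_sum_scaleR_mult
      by (intro sum.cong) (auto simp: orth idem)
    then show ?thesis by simp
  qed
  show ?thesis
    unfolding decomposition_coeffs_def
  proof (rule the_equality)
    fix mu :: "real ^ 'n"
    assume "(\<Sum>i\<in>UNIV. lam $ i *\<^sub>R P i) = (\<Sum>i\<in>UNIV. mu $ i *\<^sub>R P i)"
    then have "lam $ j *\<^sub>R P j = mu $ j *\<^sub>R P j" for j
      by (metis pick)
    then have "lam $ j = mu $ j" for j
      using nz[of j] by (metis scaleR_right_imp_eq)
    then show "mu = lam"
      by (simp add: vec_eq_iff)
  qed simp
qed

text \<open>Hermiticity, the quadratic form and the trace all respect real linear combinations;
  nonnegative weights keep the form nonnegative, and total weight 1 keeps the trace.\<close>

lemma density_op_convex_sum: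
  fixes S :: "'n::finite \<Rightarrow> 'b::finite operator"
  assumes S: "\<And>i. density_op (S i)" and c: "\<And>i. 0 \<le> c i" "(\<Sum>i\<in>UNIV. c i) = 1"
  shows "density_op (\<Sum>i\<in>UNIV. c i *\<^sub>R S i)"
proof -
  have herm: "cnj (S i $ l $ k) = S i $ k $ l" for i k l
    using S[of i]
    by (simp add: density_op_def positive_op_def hermitian_op_def adjoint_op_def vec_eq_iff)
  have "hermitian_op (\<Sum>i\<in>UNIV. c i *\<^sub>R S i)"
    by (simp add: hermitian_op_def adjoint_op_def vec_eq_iff herm)
  moreover have "0 \<le> Re (\<Sum>k\<in>UNIV. cnj (v $ k) * ((\<Sum>i\<in>UNIV. c i *\<^sub>R S i) *v v) $ k)" for v
  proof -
    have "(\<Sum>k\<in>UNIV. cnj (v $ k) * ((\<Sum>i\<in>UNIV. c i *\<^sub>R S i) *v v) $ k) =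
        (\<Sum>i\<in>UNIV. c i *\<^sub>R (\<Sum>k\<in>UNIV. cnj (v $ k) * (S i *v v) $ k))"
      by (simp add: matrix_vector_mult_def sum_distrib_right sum_distrib_left scaleR_sum_right
          sum.swap[of _ "UNIV :: 'n set"])
    moreover have "0 \<le> Re (\<Sum>k\<in>UNIV. cnj (v $ k) * (S i *v v) $ k)" for i
      using S[of i] by (simp add: density_op_def positive_op_def)
    ultimately show ?thesis
      using c(1) by (simp add: sum_nonneg del: Re_sum) (simp add: sum_nonneg)
  qed
  moreover have "trace (\<Sum>i\<in>UNIV. c i *\<^sub>R S i) = (\<Sum>i\<in>UNIV. c i *\<^sub>R trace (S i))"
    by (simp add: trace_def scaleR_sum_right sum.swap[of _ "UNIV :: 'n set"])
  then have "trace (\<Sum>i\<in>UNIV. c i *\<^sub>R S i) = 1"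
    using S c(2) by (simp add: density_op_def scaleR_conv_of_real flip: of_real_sum)
  ultimately show ?thesis
    by (simp add: density_op_def positive_op_def)
qed

text \<open>For a fixed \<open>\<rho>\<close> every operation here is linear in the catalyst factor;
  this is why mixtures of preserved catalysts are again preserved.\<close>

lemma partial_trace_evolution_sum:
  fixes S :: "'n::finite \<Rightarrow> 'b::finite operator"
  shows "partial_trace_A (U ** tensor_op \<rho> (\<Sum>i\<in>UNIV. c i *\<^sub>R S i) ** V) =
         (\<Sum>i\<in>UNIV. c i *\<^sub>R partial_trace_A (U ** tensor_op \<rho> (S i) ** V))"
  by (simp add: partial_trace_A_def matrix_matrix_mult_def tensor_op_def vec_eq_iff
      sum_distrib_right sum_distrib_left scaleR_sum_right sum.swap[of _ "UNIV :: 'n set"])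

lemma preserved_catalyst_convex_sum:
  fixes S :: "'n::finite \<Rightarrow> 'b::finite operator"
  assumes "\<And>i. preserved_catalyst U (S i)" "\<And>i. 0 \<le> c i" "(\<Sum>i\<in>UNIV. c i) = 1"
  shows "preserved_catalyst U (\<Sum>i\<in>UNIV. c i *\<^sub>R S i)"
  using assms
  by (simp add: preserved_catalyst_def density_op_convex_sum partial_trace_evolution_sum)

theorem corollary11:
  fixes U :: "('a::finite \<times> 'b::finite) operator"
    and P :: "'n::finite \<Rightarrow> 'b operator"
    and r :: "real ^ 'n"
    and \<alpha> :: real
  assumes "catalysis U P"
    and "r = degeneracy_vector P"
    and "\<alpha> \<in> {0<..<1} \<union> {1<..}"
  shows "(\<exists>\<sigma>. compatible_catalyst U P \<sigma> \<and>
              catalytic_renyi_entropy \<alpha> P \<sigma> = 2 * log 2 (norm r)) \<and>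
         (\<forall>\<sigma>. compatible_catalyst U P \<sigma> \<longrightarrow>
              catalytic_renyi_entropy \<alpha> P \<sigma> \<le> 2 * log 2 (norm r))"
proof -
  have \<alpha>: "0 < \<alpha>" "\<alpha> \<noteq> 1"
    using assms(3) by auto
  have r_ge: "1 \<le> r $ i" for i
    using assms(1,2) by (simp add: catalysis_def)
  then have r: "0 < r $ i" for i
    by (smt (verit))
  have nz: "P i \<noteq> 0" for i
    using r[of i] assms(2) by (auto simp: degeneracy_vector_def trace_def)
  have coeffs: "decomposition_coeffs P (\<Sum>i\<in>UNIV. lam $ i *\<^sub>R P i) = lam" for lam
    using assms(1) nz by (intro decomposition_coeffs_eq) (auto simp: catalysis_def projector_def)
  define R where "R = (\<Sum>i\<in>UNIV. (r $ i)\<^sup>2)"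
  have R: "0 < R"
    unfolding R_def by (intro sum_pos zero_less_power r) simp_all
  \<comment> \<open>The norm is the square root of \<open>R\<close>, and the factor 2 cancels the
    root.\<close>
  have norm_r: "2 * log 2 (norm r) = log 2 R"
    using R by (simp add: norm_vec_def L2_set_def R_def log_def ln_sqrt)
  have "catalytic_renyi_entropy \<alpha> P \<sigma> \<le> log 2 R" if "compatible_catalyst U P \<sigma>" for \<sigma>
  proof -
    obtain lam :: "real ^ 'n" where lam: "\<And>i. 0 \<le> lam $ i"
      "(\<Sum>i\<in>UNIV. lam $ i * r $ i) = 1" "\<sigma> = (\<Sum>i\<in>UNIV. lam $ i *\<^sub>R P i)"
      using \<open>compatible_catalyst U P \<sigma>\<close> assms(2) by (auto simp: compatible_catalyst_def)
    show ?thesis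
      unfolding catalytic_renyi_entropy_def lam(3) coeffs R_def assms(2)[symmetric]
      by (rule powr_sum_entropy_le[OF lam(1) r lam(2) \<alpha>])
  qed
  moreover have "\<exists>\<sigma>. compatible_catalyst U P \<sigma> \<and> catalytic_renyi_entropy \<alpha> P \<sigma> = log 2 R"
  proof -
    \<comment> \<open>Equality in Jensen's inequality asks for equal ratios
      \<open>lam $ i / r $ i\<close>; the normalisation fixes their common value as
      \<open>1 / R\<close>.\<close>
    define lam :: "real ^ 'n" where "lam = (\<chi> i. r $ i / R)"
    define \<sigma> where "\<sigma> = (\<Sum>i\<in>UNIV. lam $ i *\<^sub>R P i)"
    have lam_nonneg: "0 \<le> lam $ i" for i
      using r[of i] R by (simp add: lam_def)
    have lam_sum: "(\<Sum>i\<in>UNIV. lam $ i * r $ i) = 1"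
      using R by (simp add: lam_def R_def power2_eq_square flip: sum_divide_distrib)
    \<comment> \<open>Rewritten as a mixture of the normalised projectors with probabilities
      \<open>lam $ i * r $ i\<close>, the candidate inherits preservation from them by
      convexity.\<close>
    have "\<sigma> = (\<Sum>i\<in>UNIV. (lam $ i * r $ i) *\<^sub>R ((1 / r $ i) *\<^sub>R P i))"
      unfolding \<sigma>_def using r by (intro sum.cong) (auto simp: less_imp_neq[OF r, symmetric])
    moreover have "preserved_catalyst U ((1 / r $ i) *\<^sub>R P i)" for i
      using assms(1,2) by (simp add: catalysis_def)
    ultimately have "preserved_catalyst U \<sigma>"
      using lam_nonneg lam_sum r
      by (simp only:) (intro preserved_catalyst_convex_sum; simp add: less_imp_le)
    then have "compatible_catalyst U P \<sigma>"
      using lam_nonneg lam_sum \<sigma>_def assms(2) unfolding compatible_catalyst_def by blast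
    moreover have "catalytic_renyi_entropy \<alpha> P \<sigma> = log 2 R"
      unfolding catalytic_renyi_entropy_def \<sigma>_def coeffs assms(2)[symmetric]
      using powr_sum_entropy_eq[of "($) r" \<alpha> R, OF r \<alpha>(2) R_def] by (simp add: lam_def)
    ultimately show ?thesis
      by blast
  qed
  ultimately show ?thesis
    by (simp add: norm_r)
qed

end
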